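(* Let $F$ be a field, $\lambda\ge 0$ an integer, and $A_1,\dots,A_n$ $\lambda$-null finite subsets of $F$. Assume that $f\in F[X_1,\dots,X_n]$ satisfies \[\deg(f)\leq(|A_1|-1)+\dots+(|A_n|-1)+\lambda.\] Then the coefficient of the monomial $X_1^{|A_1|-1}\cdots X_n^{|A_n|-1}$ in $f$ equals \[\sum_{a\in A_1\times\dots\times A_n}w_a\,f(a).\]
   Context: For a finite non-empty $A\subseteq F$, $\Pi_A(X)=\prod_{a\in A}(X-a)$; $A$ is $\lambda$-null (for $\lambda\in\{0,\dots,|A|\}$) if in $\Pi_A(X)$ the coefficients of $X^{|A|-1},\dots,X^{|A|-\lambda}$ vanish. For $a=(a_1,\dots,a_n)\in A_1\times\dots\times A_n$, put $w_a=\frac{1}{\Pi'_{A_1}(a_1)\cdots\Pi'_{A_n}(a_n)}$, where $\Pi'_A$ is the formal derivative, so $\Pi'_A(a)=\prod_{b\in A,\,b\ne a}(a-b)\neq 0$ for $a\in A$. $\deg(f)$ is the total degree. *)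

theory Defs
  imports
    "HOL-Computational_Algebra.Polynomial"
    "HOL-Library.Poly_Mapping"
    "HOL-Library.FuncSet"
begin

text \<open>
  Multivariate polynomials are finitely supported maps from exponent vectors (finitely supported
  maps from variable indices to exponents) to coefficients; the variable \<open>X\<^sub>i\<close> has index \<open>i\<close>.
  The coefficient of a monomial \<open>m\<close> in \<open>f\<close> is \<open>Poly_Mapping.lookup f m\<close>.
\<close>

type_synonym 'a mvpoly = "(nat \<Rightarrow>\<^sub>0 nat) \<Rightarrow>\<^sub>0 'a"

definition poly_vars :: "'a::zero mvpoly \<Rightarrow> nat set"
  where "poly_vars f = (\<Union>m\<in>Poly_Mapping.keys f. Poly_Mapping.keys m)"

definition monom_degree :: "(nat \<Rightarrow>\<^sub>0 nat) \<Rightarrow> nat"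
  where "monom_degree m = (\<Sum>i\<in>Poly_Mapping.keys m. Poly_Mapping.lookup m i)"

text \<open>The zero polynomial gets total degree \<open>0\<close>, so it satisfies every upper bound in \<open>nat\<close>.\<close>

definition total_degree :: "'a::zero mvpoly \<Rightarrow> nat"
  where "total_degree f = Max (insert 0 (monom_degree ` Poly_Mapping.keys f))"

definition eval_mvpoly :: "'a::comm_semiring_1 mvpoly \<Rightarrow> (nat \<Rightarrow> 'a) \<Rightarrow> 'a"
  where "eval_mvpoly f a = (\<Sum>m\<in>Poly_Mapping.keys f.
    Poly_Mapping.lookup f m * (\<Prod>i\<in>Poly_Mapping.keys m. a i ^ Poly_Mapping.lookup m i))"

definition root_poly :: "'a::field set \<Rightarrow> 'a poly"
  where "root_poly A = (\<Prod>a\<in>A. [:- a, 1:])"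

definition null_set_of_order :: "nat \<Rightarrow> 'a::field set \<Rightarrow> bool"
  where "null_set_of_order l A \<longleftrightarrow>
    finite A \<and> A \<noteq> {} \<and> l \<le> card A \<and> (\<forall>k\<in>{1..l}. coeff (root_poly A) (card A - k) = 0)"

definition grid_weight :: "nat \<Rightarrow> (nat \<Rightarrow> 'a::field set) \<Rightarrow> (nat \<Rightarrow> 'a) \<Rightarrow> 'a"
  where "grid_weight n A a = 1 / (\<Prod>i=1..n. poly (pderiv (root_poly (A i))) (a i))"

end

theory Submission
  imports Defs
begin

text \<open>
  For a single set \<open>A\<close>, Lagrange interpolation shows that
  \<open>\<Sum>a\<in>A. p a / \<Pi>' a\<close> is the coefficient of \<open>X ^ (card A - 1)\<close> in \<open>p\<close> whenever
  \<open>degree p < card A\<close>. If \<open>A\<close> is \<open>l\<close>-null then, on \<open>A\<close>, the power \<open>X ^ card A\<close> agrees with a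
  polynomial of degree less than \<open>card A - l\<close>, so the power sums with exponents
  \<open>card A, \<dots>, card A - 1 + l\<close> vanish as well. On the grid, the weighted sum of a monomial is a
  product of such one-variable power sums; under the degree bound, every monomial other than the
  target has a factor that vanishes.
\<close>

text \<open>By the product rule applied to the split-off factor \<open>X - a\<close>: the summand
  that keeps this factor vanishes at \<open>a\<close>.\<close>

lemma poly_pderiv_root_poly:
  fixes A :: "'a::field set"
  assumes "finite A" "a \<in> A"
  shows "poly (pderiv (root_poly A)) a = (\<Prod>b\<in>A - {a}. a - b)"
proof -
  have "root_poly A = [:- a, 1:] * root_poly (A - {a})"
    using assms by (simp only: root_poly_def prod.remove)
  then show ?thesis
    by (simp only: pderiv_mult) (simp add: root_poly_def poly_prod pderiv_pCons)
qed

lemma degree_root_poly: "finite A \<Longrightarrow> degree (root_poly A) = card A"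
  by (simp add: root_poly_def degree_prod_sum_eq)

lemma monic_root_poly: "finite A \<Longrightarrow> coeff (root_poly A) (card A) = 1"
  using degree_root_poly[of A] lead_coeff_prod[of "\<lambda>a. [:- a, 1:]" A]
  by (simp add: root_poly_def)

text \<open>The Lagrange interpolant \<open>q\<close> of \<open>p\<close> on \<open>A\<close> is
  written with the unnormalised basis \<open>root_poly (A - {a})\<close>, the denominators being
  absorbed into \<open>c a\<close>. Each basis element is monic of degree \<open>card A - 1\<close>,
  so the top coefficient is the sum of the \<open>c a\<close>.\<close>

lemma sum_poly_div_pderiv_root_poly:
  fixes A :: "'a::field set"
  assumes "finite A" "degree p < card A"
  shows "(\<Sum>a\<in>A. poly p a / poly (pderiv (root_poly A)) a) = coeff p (card A - 1)"
proof -
  define c where "c = (\<lambda>a. poly p a / poly (pderiv (root_poly A)) a)"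
  define q where "q = (\<Sum>a\<in>A. smult (c a) (root_poly (A - {a})))"
  have "p = q"
  proof (rule poly_eqI_degree)
    fix x assume x: "x \<in> A"
    \<comment> \<open>At a node \<open>x\<close>, every basis element except the one for
      \<open>x\<close> contains the factor \<open>X - x\<close>.\<close>
    have "poly q x = (\<Sum>a\<in>A. if a = x then c x * (\<Prod>b\<in>A - {x}. x - b) else 0)"
      unfolding q_def poly_sum using assms(1) x
      by (intro sum.cong) (auto simp: root_poly_def poly_prod)
    also have "\<dots> = poly p x"
      using assms(1) x by (simp add: c_def poly_pderiv_root_poly)
    finally show "poly p x = poly q x" by simp
  next
    show "degree p < card A" by fact
    have "degree q \<le> card A - 1"
      unfolding q_def using assms(1)
      by (intro degree_sum_le) (auto intro!: degree_smult_le[THEN order_trans] simp: degree_root_poly)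
    with assms show "degree q < card A" by linarith
  qed
  moreover have "coeff q (card A - 1) = (\<Sum>a\<in>A. c a)"
    unfolding q_def coeff_sum
  proof (rule sum.cong)
    fix a assume "a \<in> A"
    then show "coeff (smult (c a) (root_poly (A - {a}))) (card A - 1) = c a"
      using assms(1) monic_root_poly[of "A - {a}"] by simp
  qed simp
  ultimately show ?thesis by (simp add: c_def)
qed

lemma sum_power_div_pderiv_root_poly:
  fixes A :: "'a::field set"
  assumes null: "null_set_of_order l A" and k: "k \<le> card A - 1 + l"
  shows "(\<Sum>a\<in>A. a ^ k / poly (pderiv (root_poly A)) a) = (if k = card A - 1 then 1 else 0)"
proof -
  have fin: "finite A" and pos: "card A > 0" and l: "l \<le> card A"
    and coeff0: "\<And>i. i \<in> {1..l} \<Longrightarrow> coeff (root_poly A) (card A - i) = 0"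
    using null by (auto simp: null_set_of_order_def card_gt_0_iff)
  show ?thesis
  proof (cases "k < card A")
    case True
    then show ?thesis
      using sum_poly_div_pderiv_root_poly[of A "monom 1 k"] fin
      by (auto simp: poly_monom degree_monom_eq)
  next
    case False
    define j where "j = k - card A"
    have j: "k = j + card A" "j < l" using False k pos by (auto simp: j_def)
    \<comment> \<open>\<open>R\<close> is the remainder of \<open>X ^ card A\<close> modulo
      \<open>root_poly A\<close>. Both leading terms are 1 and cancel; nullity removes the next
      \<open>l\<close> coefficients.\<close>
    define R where "R = monom 1 (card A) - root_poly A"
    have R0: "coeff R i = 0" if "i \<ge> card A - l" for i
    proof -
      consider "i > card A" | "i = card A" | "i < card A" by linarith
      then show ?thesis
      proof cases
        case 1
        then show ?thesis
          using degree_root_poly[OF fin] by (simp add: R_def coeff_eq_0)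
      next
        case 2
        then show ?thesis using monic_root_poly[OF fin] by (simp add: R_def)
      next
        case 3
        then have "card A - i \<in> {1..l}" "card A - (card A - i) = i" using that by auto
        then show ?thesis using 3 coeff0[of "card A - i"] by (simp add: R_def)
      qed
    qed
    \<comment> \<open>\<open>q\<close> takes the value \<open>a ^ k\<close> at each \<open>a\<close>
      in \<open>A\<close>. Since \<open>j < l\<close>, the shift by \<open>j\<close> keeps all its
      nonzero coefficients below index \<open>card A - 1\<close>.\<close>
    define q where "q = monom 1 j * R"
    have q0: "coeff q i = 0" if "i \<ge> card A - 1" for i
    proof (cases "i < j")
      case True
      then show ?thesis by (simp add: q_def coeff_monom_mult)
    next
      case False
      then show ?thesis using that j(2) l by (simp add: q_def coeff_monom_mult R0)
    qed
    \<comment> \<open>A strict inequality would fail for \<open>card A = 1\<close>, where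
      \<open>q\<close> is zero and has degree 0. That the coefficient at \<open>card A - 1\<close>
      vanishes is taken from \<open>q0\<close> instead.\<close>
    have "degree q \<le> card A - 1"
      by (rule degree_le) (simp add: q0)
    with pos have "degree q < card A" by linarith
    then have "(\<Sum>a\<in>A. poly q a / poly (pderiv (root_poly A)) a) = 0"
      using sum_poly_div_pderiv_root_poly[of A q] fin q0[of "card A - 1"] by simp
    moreover have "poly q a = a ^ k" if "a \<in> A" for a
    proof -
      have "poly (root_poly A) a = 0"
        using that fin by (auto simp: root_poly_def poly_prod)
      then show ?thesis by (simp add: q_def R_def poly_monom j(1) power_add)
    qed
    ultimately show ?thesis using False pos by simp
  qed
qed

lemma sum_grid_weight_monom:
  fixes A :: "nat \<Rightarrow> 'a::field set"
  assumes null: "\<And>i. i \<in> {1..n} \<Longrightarrow> null_set_of_order l (A i)"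
    and keys: "Poly_Mapping.keys m \<subseteq> {1..n}"
    and deg: "monom_degree m \<le> (\<Sum>i=1..n. card (A i) - 1) + l"
  shows "(\<Sum>a\<in>PiE {1..n} A. grid_weight n A a *
      (\<Prod>i\<in>Poly_Mapping.keys m. a i ^ Poly_Mapping.lookup m i)) =
    (if m = (\<Sum>i=1..n. Poly_Mapping.single i (card (A i) - 1)) then 1 else 0)"
proof -
  define e where "e = Poly_Mapping.lookup m"
  define d where "d = (\<lambda>i. card (A i) - 1)"
  define S where "S = (\<lambda>i. \<Sum>x\<in>A i. x ^ e i / poly (pderiv (root_poly (A i))) x)"
  have e0: "e i = 0" if "i \<notin> {1..n}" for i
    using that keys by (auto simp: e_def in_keys_iff)
  \<comment> \<open>Outside \<open>{1..n}\<close> both exponent vectors are zero, so comparing them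
    there is vacuous.\<close>
  have target: "m = (\<Sum>i=1..n. Poly_Mapping.single i (d i)) \<longleftrightarrow> (\<forall>i\<in>{1..n}. e i = d i)"
    using e0 by (fastforce simp: poly_mapping_eq_iff fun_eq_iff lookup_sum lookup_single when_def e_def
        sum.delta)
  have deg_e: "(\<Sum>i=1..n. e i) \<le> (\<Sum>i=1..n. d i) + l"
  proof -
    have "monom_degree m = (\<Sum>i=1..n. e i)"
      unfolding monom_degree_def e_def using keys
      by (intro sum.mono_neutral_left) (auto simp: in_keys_iff)
    then show ?thesis using deg by (simp add: d_def)
  qed
  have "(\<Prod>i\<in>Poly_Mapping.keys m. a i ^ Poly_Mapping.lookup m i) = (\<Prod>i=1..n. a i ^ e i)"
    for a :: "nat \<Rightarrow> 'a"
    unfolding e_def using keys by (intro prod.mono_neutral_left) (auto simp: in_keys_iff)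
  then have "(\<Sum>a\<in>PiE {1..n} A. grid_weight n A a *
      (\<Prod>i\<in>Poly_Mapping.keys m. a i ^ Poly_Mapping.lookup m i)) =
      (\<Sum>a\<in>PiE {1..n} A. \<Prod>i=1..n. a i ^ e i / poly (pderiv (root_poly (A i))) (a i))"
    by (simp add: grid_weight_def prod_dividef)
  also have "\<dots> = (\<Prod>i=1..n. S i)"
    unfolding S_def using null
    by (intro prod_sum_PiE[symmetric]) (auto simp: null_set_of_order_def)
  also have "\<dots> = (if \<forall>i\<in>{1..n}. e i = d i then 1 else 0)"
  \<comment> \<open>An exponent in the range of the one-variable lemma and different from
    \<open>d i\<close> kills the product. Otherwise each exponent is \<open>d i\<close> or exceeds
    \<open>d i + l\<close>.\<close>
  proof (cases "\<exists>i\<in>{1..n}. e i \<le> d i + l \<and> e i \<noteq> d i")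
    case True
    then obtain i where i: "i \<in> {1..n}" "e i \<le> d i + l" "e i \<noteq> d i" by blast
    then have "S i = 0"
      unfolding S_def using sum_power_div_pderiv_root_poly[OF null, of i "e i"] by (simp add: d_def)
    then show ?thesis using i by force
  next
    case False
    have ge: "e i \<ge> d i" if "i \<in> {1..n}" for i
    proof (rule ccontr)
      assume "\<not> e i \<ge> d i"
      then have "e i \<le> d i + l \<and> e i \<noteq> d i" by linarith
      with False that show False by blast
    qed
    have eq: "e i = d i" if i: "i \<in> {1..n}" for i
    proof -
      \<comment> \<open>The other exponents already use up their share \<open>d\<close> of the
        total, so the whole slack left for \<open>e i\<close> beyond \<open>d i\<close> is
        \<open>l\<close>.\<close>
      have "(\<Sum>i\<in>{1..n} - {i}. d i) \<le> (\<Sum>i\<in>{1..n} - {i}. e i)"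
        by (intro sum_mono) (use ge in auto)
      then have "e i \<le> d i + l"
        using deg_e sum.remove[OF finite_atLeastAtMost i, of e] sum.remove[OF finite_atLeastAtMost i, of d]
        by linarith
      then show ?thesis using False i by blast
    qed
    then have "S i = 1" if "i \<in> {1..n}" for i
      unfolding S_def using that sum_power_div_pderiv_root_poly[OF null, of i "e i"]
      by (simp add: d_def)
    then show ?thesis using eq by simp
  qed
  finally show ?thesis using target by (simp add: d_def)
qed

theorem theorem6p2:
  fixes A :: "nat \<Rightarrow> 'a::field set" and f :: "'a mvpoly" and n l :: nat
  assumes "\<And>i. i \<in> {1..n} \<Longrightarrow> null_set_of_order l (A i)"
    and "poly_vars f \<subseteq> {1..n}"
    and "total_degree f \<le> (\<Sum>i=1..n. card (A i) - 1) + l"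
  shows "Poly_Mapping.lookup f (\<Sum>i=1..n. Poly_Mapping.single i (card (A i) - 1)) =
    (\<Sum>a\<in>PiE {1..n} A. grid_weight n A a * eval_mvpoly f a)"
proof -
  let ?t = "\<Sum>i=1..n. Poly_Mapping.single i (card (A i) - 1)"
  let ?c = "Poly_Mapping.lookup f"
  have monom: "(\<Sum>a\<in>PiE {1..n} A. grid_weight n A a *
      (\<Prod>i\<in>Poly_Mapping.keys m. a i ^ Poly_Mapping.lookup m i)) = (if m = ?t then 1 else 0)"
    if m: "m \<in> Poly_Mapping.keys f" for m
  proof (rule sum_grid_weight_monom)
    show "Poly_Mapping.keys m \<subseteq> {1..n}"
      using m assms(2) by (auto simp: poly_vars_def)
    have "monom_degree m \<le> total_degree f"
      unfolding total_degree_def using m by (intro Max_ge) auto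
    then show "monom_degree m \<le> (\<Sum>i=1..n. card (A i) - 1) + l"
      using assms(3) by linarith
  qed (use assms(1) in auto)
  have "(\<Sum>a\<in>PiE {1..n} A. grid_weight n A a * eval_mvpoly f a) =
      (\<Sum>m\<in>Poly_Mapping.keys f. ?c m * (\<Sum>a\<in>PiE {1..n} A. grid_weight n A a *
        (\<Prod>i\<in>Poly_Mapping.keys m. a i ^ Poly_Mapping.lookup m i)))"
    unfolding eval_mvpoly_def sum_distrib_left
    by (subst sum.swap) (simp add: mult.left_commute)
  also have "\<dots> = (\<Sum>m\<in>Poly_Mapping.keys f. if m = ?t then ?c ?t else 0)"
    by (intro sum.cong refl, subst monom) auto
  also have "\<dots> = ?c ?t"
    \<comment> \<open>If \<open>?t\<close> is not a key of \<open>f\<close>, the sum is empty of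
      nonzero terms and \<open>?c ?t\<close> is 0 as well.\<close>
    by (auto simp: sum.delta in_keys_iff)
  finally show ?thesis by simp
qed

end
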